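(* Let $n\geq m\geq 1$ be integers and let $G_{n,m}$ be the complement of the $n\times m$ rook's graph. Then \[\chi_{\mathrm{cen}}(G_{n,m})=\chi_{\mathrm{lin}}(G_{n,m})=\begin{cases} nm-n+1 & \text{if } m\geq 2 \text{ and } n\geq 3,\\ m & \text{otherwise.}\end{cases}\]
   Context: The $n\times m$ rook's graph has $nm$ vertices arranged into $m$ columns of $n$ vertices and $n$ rows of $m$ vertices, two vertices being adjacent iff they lie in the same row or the same column; its complement therefore has two distinct vertices adjacent iff they lie in different rows and different columns. A centered coloring of a graph $G$ assigns integers (colors) to vertices so that every connected subgraph contains a vertex whose color is unique in that subgraph; $\chi_{\mathrm{cen}}(G)$ is the minimum number of colors of such a coloring. A linear coloring requires the same only for every path of $G$ (as a subgraph); $\chi_{\mathrm{lin}}(G)$ is the minimum number of colors of a linear coloring. *)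

theory Defs
  imports "Graph_Theory.Graph_Theory"
begin

text \<open>
  Undirected simple graphs are symmetric loop-free digraphs, as in the Graph_Theory library.
  A vertex \<open>(i, j)\<close> of the rook's graph lies in row \<open>i < n\<close> and column \<open>j < m\<close>.
\<close>

definition rook_graph :: "nat \<Rightarrow> nat \<Rightarrow> (nat \<times> nat) pair_pre_digraph" where
  "rook_graph n m =
    \<lparr> pverts = {..<n} \<times> {..<m},
      parcs = {(u, v). u \<in> {..<n} \<times> {..<m} \<and> v \<in> {..<n} \<times> {..<m} \<and> u \<noteq> v \<and>
                       (fst u = fst v \<or> snd u = snd v)} \<rparr>"

definition complement_graph :: "'a pair_pre_digraph \<Rightarrow> 'a pair_pre_digraph" where
  "complement_graph G =
    \<lparr> pverts = pverts G,
      parcs = {(u, v). u \<in> pverts G \<and> v \<in> pverts G \<and> u \<noteq> v \<and> (u, v) \<notin> parcs G} \<rparr>"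

definition has_unique_color :: "('a \<Rightarrow> int) \<Rightarrow> 'a set \<Rightarrow> bool" where
  "has_unique_color c S \<longleftrightarrow> (\<exists>v\<in>S. \<forall>u\<in>S. c u = c v \<longrightarrow> u = v)"

text \<open>
  The library's \<open>subgraph\<close> may drop one of two opposite arcs, so \<open>symmetric H\<close> is what makes
  \<open>H\<close> a subgraph of the undirected graph; \<open>connected\<close> excludes the empty graph.
\<close>

definition centered_coloring :: "('a, 'b) pre_digraph \<Rightarrow> ('a \<Rightarrow> int) \<Rightarrow> bool" where
  "centered_coloring G c \<longleftrightarrow>
    (\<forall>H. subgraph H G \<and> symmetric H \<and> connected H \<longrightarrow> has_unique_color c (verts H))"

definition linear_coloring :: "('a, 'b) pre_digraph \<Rightarrow> ('a \<Rightarrow> int) \<Rightarrow> bool" where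
  "linear_coloring G c \<longleftrightarrow> (\<forall>p. vpath p G \<longrightarrow> has_unique_color c (set p))"

definition chi_cen :: "('a, 'b) pre_digraph \<Rightarrow> nat" where
  "chi_cen G = (LEAST k. \<exists>c. centered_coloring G c \<and> card (c ` verts G) = k)"

definition chi_lin :: "('a, 'b) pre_digraph \<Rightarrow> nat" where
  "chi_lin G = (LEAST k. \<exists>c. linear_coloring G c \<and> card (c ` verts G) = k)"

lemma pair_graph_rook_graph: "pair_graph (rook_graph n m)"
proof -
  have "parcs (rook_graph n m) \<subseteq> ({..<n} \<times> {..<m}) \<times> ({..<n} \<times> {..<m})"
    by (auto simp: rook_graph_def)
  then have "finite (parcs (rook_graph n m))"
    by (rule finite_subset) simp
  then show ?thesis
    by unfold_locales (auto simp: rook_graph_def symmetric_def sym_def)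
qed

lemma pair_graph_complement_graph:
  assumes "pair_graph G"
  shows "pair_graph (complement_graph G)"
proof -
  interpret pair_graph G by (rule assms)
  have "parcs (complement_graph G) \<subseteq> pverts G \<times> pverts G"
    by (auto simp: complement_graph_def)
  then have "finite (parcs (complement_graph G))"
    by (rule finite_subset) (simp add: pair_finite_verts)
  moreover have "sym (parcs G)"
    using pair_sym_arcs by (simp add: symmetric_def)
  ultimately show ?thesis
    by unfold_locales
      (auto simp: complement_graph_def symmetric_def pair_finite_verts dest: symD intro!: symI)
qed

lemma complement_rook_graph_arcs:
  "parcs (complement_graph (rook_graph n m)) =
    {(u, v). u \<in> {..<n} \<times> {..<m} \<and> v \<in> {..<n} \<times> {..<m} \<and> fst u \<noteq> fst v \<and> snd u \<noteq> snd v}"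
  by (auto simp: complement_graph_def rook_graph_def)

lemma colorings_exist:
  fixes G :: "('a, 'b) pre_digraph"
  assumes "finite (verts G)"
  shows "\<exists>c. centered_coloring G c" and "\<exists>c. linear_coloring G c"
proof -
  obtain f :: "'a \<Rightarrow> nat" where f: "inj_on f (verts G)"
    using finite_imp_inj_to_nat_seg[OF assms] by blast
  have uniq: "has_unique_color (\<lambda>v. int (f v)) S" if "S \<subseteq> verts G" "S \<noteq> {}" for S
    using that inj_on_subset[OF f that(1)] by (auto simp: has_unique_color_def inj_on_def)
  have "centered_coloring G (\<lambda>v. int (f v))"
    unfolding centered_coloring_def
    by (auto intro!: uniq simp: subgraph_def connected_def strongly_connected_def mk_symmetric_def)
  then show "\<exists>c. centered_coloring G c" by blast
  have "linear_coloring G (\<lambda>v. int (f v))"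
    unfolding linear_coloring_def by (auto intro!: uniq simp: vpath_def vwalk_def)
  then show "\<exists>c. linear_coloring G c" by blast
qed

end

theory Submission
  imports Defs
begin

text \<open>
  Giving one column a single color and all other vertices private colors is a centered coloring
  with \<open>n * m - n + 1\<close> colors. Conversely, in a linear coloring of the grid adjacent vertices get
  different colors, so any two vertices of the same color lie in a common row or column. Short
  paths on which every color occurs twice show that such pairs in different rows use the same two
  columns, that at most two rows contain pairs (the \<open>2 \<times> 3\<close> grid has a Hamiltonian path), and that
  a pair in a row and a pair in a column must meet the crossing point. In every configuration that
  survives, deleting fewer than \<open>max n m\<close> vertices (typically a line minus one vertex) leaves an
  injectively colored set.
\<close>

section \<open>Linear colorings of the grid\<close>

text \<open>Paths are plain lists of cells, so that explicit candidate paths can be checked by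
  simplification. No order between \<open>n\<close> and \<open>m\<close> is fixed, which lets rows
  and columns be exchanged.\<close>

locale linear_grid_coloring =
  fixes n m :: nat and c :: "nat \<times> nat \<Rightarrow> int"
  assumes path_unique_color:
    "\<lbrakk>ps \<noteq> []; distinct ps; set ps \<subseteq> {..<n} \<times> {..<m};
      successively (\<lambda>u v. fst u \<noteq> fst v \<and> snd u \<noteq> snd v) ps\<rbrakk> \<Longrightarrow> has_unique_color c (set ps)"
begin

section \<open>Monochromatic pairs and the exchange of rows and columns\<close>

definition row_pair :: "nat \<Rightarrow> nat \<Rightarrow> nat \<Rightarrow> bool" where
  "row_pair i j j' \<longleftrightarrow> i < n \<and> j < m \<and> j' < m \<and> j \<noteq> j' \<and> c (i, j) = c (i, j')"

definition col_pair :: "nat \<Rightarrow> nat \<Rightarrow> nat \<Rightarrow> bool" where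
  "col_pair i i' j \<longleftrightarrow> i < n \<and> i' < n \<and> j < m \<and> i \<noteq> i' \<and> c (i, j) = c (i', j)"

text \<open>Interpreting the locale for the transposed grid turns each result on rows into one on
  columns.\<close>

lemma transpose: "linear_grid_coloring m n (c \<circ> prod.swap)"
proof
  fix ps :: "(nat \<times> nat) list"
  assume ps: "ps \<noteq> []" "distinct ps" "set ps \<subseteq> {..<m} \<times> {..<n}"
    "successively (\<lambda>u v. fst u \<noteq> fst v \<and> snd u \<noteq> snd v) ps"
  have "has_unique_color c (set (map prod.swap ps))"
  proof (rule path_unique_color)
    show "distinct (map prod.swap ps)"
      using ps(2) by (simp add: distinct_map)
    show "successively (\<lambda>u v. fst u \<noteq> fst v \<and> snd u \<noteq> snd v) (map prod.swap ps)"
      using ps(4) by (auto simp: successively_map elim!: successively_mono)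
  qed (use ps in auto)
  then show "has_unique_color (c \<circ> prod.swap) (set ps)"
    by (simp add: has_unique_color_def inj_eq[OF inj_swap])
qed

lemma row_pair_transpose:
  "linear_grid_coloring.row_pair m n (c \<circ> prod.swap) i j j' \<longleftrightarrow> col_pair j j' i"
  by (auto simp: linear_grid_coloring.row_pair_def[OF transpose] col_pair_def)

lemma col_pair_transpose:
  "linear_grid_coloring.col_pair m n (c \<circ> prod.swap) i i' j \<longleftrightarrow> row_pair j i i'"
  by (auto simp: linear_grid_coloring.col_pair_def[OF transpose] row_pair_def)

lemma card_colors_transpose:
  "card ((c \<circ> prod.swap) ` ({..<m} \<times> {..<n})) = card (c ` ({..<n} \<times> {..<m}))"
  by (simp only: image_comp[symmetric] product_swap)

lemma row_pair_commute: "row_pair i j j' \<longleftrightarrow> row_pair i j' j"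
  by (auto simp: row_pair_def)

lemma col_pair_commute: "col_pair i i' j \<longleftrightarrow> col_pair i' i j"
  by (auto simp: col_pair_def)

section \<open>Configurations of pairs excluded by explicit paths\<close>

lemma no_repeating_path:
  assumes "ps \<noteq> []" "distinct ps" "set ps \<subseteq> {..<n} \<times> {..<m}"
    "successively (\<lambda>u v. fst u \<noteq> fst v \<and> snd u \<noteq> snd v) ps"
    and "\<forall>v\<in>set ps. \<exists>u\<in>set ps. u \<noteq> v \<and> c u = c v"
  shows False
  using path_unique_color[OF assms(1-4)] assms(5) unfolding has_unique_color_def by metis

lemma adjacent_colors_differ:
  assumes "i < n" "i' < n" "j < m" "j' < m" "i \<noteq> i'" "j \<noteq> j'"
  shows "c (i, j) \<noteq> c (i', j')"
proof
  assume "c (i, j) = c (i', j')"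
  then show False
    using assms by (intro no_repeating_path[of "[(i, j), (i', j')]"]) auto
qed

text \<open>A path that alternates between the two rows visits both pairs, repeating each color. It
  exists once some column of one pair is missing from the other.\<close>

lemma row_pairs_same_columns:
  assumes "row_pair i j j'" "row_pair i' k k'" "i \<noteq> i'"
  shows "{j, j'} = {k, k'}"
proof -
  have no: False if "row_pair i j j'" "row_pair i' k k'" "k \<noteq> j" "k \<noteq> j'" "k' \<noteq> j'" for j j' k k'
    using that assms(3)
    by (intro no_repeating_path[of "[(i, j), (i', k), (i, j'), (i', k')]"])
      (simp_all add: row_pair_def)
  have k: "k = j \<or> k = j'" if "row_pair i' k k'" for k k'
  proof (rule ccontr)
    assume "\<not> (k = j \<or> k = j')"
    \<comment> \<open>With \<open>k\<close> outside the first pair, the zigzag only needs its two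
      last cells in different columns. Since \<open>k'\<close> cannot equal both \<open>j\<close>
      and \<open>j'\<close>, one of the two orders of the first pair works.\<close>
    moreover have "k' \<noteq> j \<or> k' \<noteq> j'"
      using assms(1) by (auto simp: row_pair_def)
    ultimately show False
      using no[of j j' k k'] no[of j' j k k'] that assms(1) row_pair_commute by blast
  qed
  have "k \<noteq> k'"
    using assms(2) by (simp add: row_pair_def)
  then show ?thesis
    using k[of k k'] k[of k' k] assms(2) row_pair_commute by blast
qed

text \<open>If the pairs share neither a row nor a column, each cell of one is adjacent to each cell
  of the other, so they can be visited alternately.\<close>

lemma row_col_pair_meet:
  assumes "row_pair i j j'" "col_pair l l' k"
  shows "k \<in> {j, j'} \<or> i \<in> {l, l'}"
proof (rule ccontr)
  assume "\<not> ?thesis"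
  then show False
    using assms
    by (intro no_repeating_path[of "[(i, j), (l, k), (i, j'), (l', k)]"])
      (simp_all add: row_pair_def col_pair_def)
qed

text \<open>If the pairs met in a cell, their other two cells would have its color while being
  adjacent to each other.\<close>

lemma row_col_pair_disjoint:
  assumes "row_pair i j j'" "col_pair l l' k" "k \<in> {j, j'}"
  shows "i \<noteq> l" "i \<noteq> l'"
  using assms adjacent_colors_differ[of i l' j' k] adjacent_colors_differ[of i l' j k]
    adjacent_colors_differ[of i l j' k] adjacent_colors_differ[of i l j k]
  by (auto simp: row_pair_def col_pair_def)

text \<open>The list is a Hamiltonian path of the 3 by 2 grid on these rows and columns.\<close>

lemma no_three_row_pairs:
  assumes "row_pair i1 a b" "row_pair i2 a b" "row_pair i3 a b" "distinct [i1, i2, i3]"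
  shows False
  using assms
  by (intro no_repeating_path[of "[(i1, a), (i2, b), (i3, a), (i1, b), (i2, a), (i3, b)]"])
    (simp_all add: row_pair_def)

text \<open>Three pairs fill a 2 by 3 grid, which the list traverses completely.\<close>

lemma no_two_row_pairs_with_col_pair:
  assumes "row_pair i1 a b" "row_pair i2 a b" "col_pair i1 i2 k" "k \<notin> {a, b}"
  shows False
  using assms
  by (intro no_repeating_path[of "[(i1, a), (i2, b), (i1, k), (i2, a), (i1, b), (i2, k)]"])
    (simp_all add: row_pair_def col_pair_def)

text \<open>Four pairs fill a 4 by 2 grid, and the list is a Hamiltonian path of it.\<close>

lemma no_two_row_pairs_two_col_pairs:
  assumes "row_pair i1 a b" "row_pair i2 a b" "col_pair l1 l2 a" "col_pair l1 l2 b"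
    "distinct [i1, i2, l1, l2]"
  shows False
  using assms
  by (intro no_repeating_path[of "[(i1, a), (i2, b), (l1, a), (l2, b),
        (i2, a), (i1, b), (l2, a), (l1, b)]"])
    (simp_all add: row_pair_def col_pair_def)

section \<open>Counting colors after deleting cells\<close>

lemma card_colors_ge:
  assumes X: "finite X"
    and row: "\<And>i j j'. row_pair i j j' \<Longrightarrow> (i, j) \<in> X \<or> (i, j') \<in> X"
    and col: "\<And>i i' j. col_pair i i' j \<Longrightarrow> (i, j) \<in> X \<or> (i', j) \<in> X"
  shows "n * m \<le> card (c ` ({..<n} \<times> {..<m})) + card X"
proof -
  let ?V = "{..<n} \<times> {..<m}"
  \<comment> \<open>Equally colored cells are not adjacent, hence form a row pair or a column pair,
    and \<open>X\<close> meets each of these.\<close>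
  have "inj_on c (?V - X)"
  proof (rule inj_onI, rule ccontr)
    fix u v assume uv: "u \<in> ?V - X" "v \<in> ?V - X" "c u = c v" "u \<noteq> v"
    obtain i j i' j' where eq: "u = (i, j)" "v = (i', j')" by fastforce
    have "i = i' \<or> j = j'"
      using adjacent_colors_differ[of i i' j j'] uv eq by auto
    then show False
      using row[of i j j'] col[of i i' j] uv eq by (auto simp: row_pair_def col_pair_def)
  qed
  then have "card (?V - X) = card (c ` (?V - X))"
    by (simp add: card_image)
  also have "\<dots> \<le> card (c ` ?V)"
    by (intro card_mono) auto
  finally have "card (?V - X) \<le> card (c ` ?V)" .
  moreover have "card ?V - card X \<le> card (?V - X)"
    by (rule diff_card_le_card_Diff[OF X])
  ultimately show ?thesis
    by (simp add: card_cartesian_product)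
qed

text \<open>The deleted set is column \<open>k\<close> without the cell \<open>(l, k)\<close>.
  Sparing this cell makes the bound strict: a column pair has another cell in that column, and no
  row pair lies in row \<open>l\<close>.\<close>

lemma card_colors_ge_column:
  assumes l: "l < n"
    and row: "\<And>i j j'. row_pair i j j' \<Longrightarrow> i \<noteq> l \<and> k \<in> {j, j'}"
    and col: "\<And>i i' j. col_pair i i' j \<Longrightarrow> j = k"
  shows "n * m < card (c ` ({..<n} \<times> {..<m})) + max n m"
proof -
  have "n * m \<le> card (c ` ({..<n} \<times> {..<m})) + card (({..<n} - {l}) \<times> {k})"
  proof (rule card_colors_ge)
    fix i j j' assume p: "row_pair i j j'"
    then have "i < n" by (simp add: row_pair_def)
    then show "(i, j) \<in> ({..<n} - {l}) \<times> {k} \<or> (i, j') \<in> ({..<n} - {l}) \<times> {k}"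
      using row[OF p] by auto
  next
    fix i i' j assume p: "col_pair i i' j"
    then show "(i, j) \<in> ({..<n} - {l}) \<times> {k} \<or> (i', j) \<in> ({..<n} - {l}) \<times> {k}"
      using col[OF p] by (auto simp: col_pair_def)
  qed simp
  moreover have "card (({..<n} - {l}) \<times> {k}) = n - 1"
    using l by (simp add: card_cartesian_product)
  ultimately show ?thesis
    using l by linarith
qed

text \<open>All row pairs then use columns \<open>a\<close>, \<open>b\<close> and rows
  \<open>i1\<close>, \<open>i2\<close>. Column pairs, if any, lie in just one of these columns and
  avoid both rows, so one of their cells can be spared.\<close>

lemma card_colors_two_rows:
  assumes "3 \<le> max n m" and p1: "row_pair i1 a b" and p2: "row_pair i2 a' b'" and "i1 \<noteq> i2"
  shows "n * m < card (c ` ({..<n} \<times> {..<m})) + max n m"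
proof -
  interpret T: linear_grid_coloring m n "c \<circ> prod.swap" by (rule transpose)
  have "{a, b} = {a', b'}"
    by (rule row_pairs_same_columns[OF p1 p2 \<open>i1 \<noteq> i2\<close>])
  then have p2': "row_pair i2 a b"
    using p2 row_pair_commute by (auto simp: doubleton_eq_iff)
  \<comment> \<open>Any row differs from \<open>i1\<close> or from \<open>i2\<close>, so one of the
    two given pairs can serve for comparison.\<close>
  have ab: "{j, j'} = {a, b}" if "row_pair i j j'" for i j j'
    using row_pairs_same_columns[OF that p1] row_pairs_same_columns[OF that p2'] \<open>i1 \<noteq> i2\<close>
    by blast
  have rows: "i = i1 \<or> i = i2" if p: "row_pair i j j'" for i j j'
  proof (rule ccontr)
    assume "\<not> ?thesis"
    moreover have "row_pair i a b"
      using p ab[OF p] row_pair_commute by (auto simp: doubleton_eq_iff)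
    ultimately show False
      using no_three_row_pairs[OF p1 p2', of i] \<open>i1 \<noteq> i2\<close> by auto
  qed
  show ?thesis
  proof (cases "\<exists>l l' k. col_pair l l' k")
    case False
    \<comment> \<open>Two deletions break all pairs; \<open>3 \<le> max n m\<close> makes this fewer
      than the maximum.\<close>
    have "n * m \<le> card (c ` ({..<n} \<times> {..<m})) + card {(i1, a), (i2, a)}"
    proof (rule card_colors_ge)
      fix i j j' assume p: "row_pair i j j'"
      then show "(i, j) \<in> {(i1, a), (i2, a)} \<or> (i, j') \<in> {(i1, a), (i2, a)}"
        using rows[OF p] ab[OF p] by (auto simp: doubleton_eq_iff)
    qed (use False in auto)
    then show ?thesis
      using assms(1) \<open>i1 \<noteq> i2\<close> by simp
  next
    case True
    then obtain l l' k where q: "col_pair l l' k" by blast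
    have cols: "k \<in> {a, b}" if q: "col_pair l l' k" for l l' k
    proof (rule ccontr)
      assume k: "k \<notin> {a, b}"
      \<comment> \<open>Outside columns \<open>a\<close> and \<open>b\<close>, the column pair must
        meet both rows, so it consists of exactly these rows.\<close>
      then have "i1 \<in> {l, l'}" "i2 \<in> {l, l'}"
        using row_col_pair_meet[OF p1 q] row_col_pair_meet[OF p2' q] by auto
      then have "col_pair i1 i2 k"
        using q \<open>i1 \<noteq> i2\<close> col_pair_commute by auto
      then show False
        using no_two_row_pairs_with_col_pair[OF p1 p2' _ k] by blast
    qed
    have disj: "i1 \<noteq> l" "i1 \<noteq> l'" "i2 \<noteq> l" "i2 \<noteq> l'"
      using row_col_pair_disjoint[OF p1 q cols[OF q]] row_col_pair_disjoint[OF p2' q cols[OF q]]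
      by auto
    have one_col: "k' = k" if q': "col_pair r r' k'" for r r' k'
    proof (rule ccontr)
      assume ne: "k' \<noteq> k"
      \<comment> \<open>By transposition, pairs in two different columns use the same rows; these
        columns would be \<open>a\<close> and \<open>b\<close>, giving the excluded 4 by 2
        pattern.\<close>
      have "{r, r'} = {l, l'}"
        using T.row_pairs_same_columns[of k' r r' k l l'] q q' ne
        by (simp add: row_pair_transpose)
      then have "col_pair l l' k'"
        using q' col_pair_commute by (auto simp: doubleton_eq_iff)
      then have "col_pair l l' a \<and> col_pair l l' b"
        using q ne cols[OF q] cols[OF q'] by auto
      then show False
        using no_two_row_pairs_two_col_pairs[OF p1 p2', of l l'] disj \<open>i1 \<noteq> i2\<close> q
        by (auto simp: col_pair_def)
    qed
    show ?thesis
    proof (rule card_colors_ge_column[of l k])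
      show "l < n" using q by (simp add: col_pair_def)
      show "i \<noteq> l \<and> k \<in> {j, j'}" if p: "row_pair i j j'" for i j j'
        using rows[OF p] ab[OF p] cols[OF q] disj by auto
    qed (rule one_col)
  qed
qed

text \<open>The column pair avoids row \<open>i\<close>, so every row pair in that row must use
  column \<open>k\<close>, and \<open>(l, k)\<close> can be spared.\<close>

lemma card_colors_one_row_one_col:
  assumes p: "row_pair i j j'" and q: "col_pair l l' k" and "k \<in> {j, j'}"
    and rows: "\<And>i' j j'. row_pair i' j j' \<Longrightarrow> i' = i"
    and cols: "\<And>r r' k'. col_pair r r' k' \<Longrightarrow> k' = k"
  shows "n * m < card (c ` ({..<n} \<times> {..<m})) + max n m"
proof (rule card_colors_ge_column[of l k])
  have disj: "i \<noteq> l" "i \<noteq> l'"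
    using row_col_pair_disjoint[OF p q \<open>k \<in> {j, j'}\<close>] by auto
  show "l < n" using q by (simp add: col_pair_def)
  show "i' \<noteq> l \<and> k \<in> {j, j'}" if "row_pair i' j j'" for i' j j'
    using row_col_pair_meet[OF that q] rows[OF that] disj by auto
qed (rule cols)

theorem card_colors_grid:
  assumes N: "3 \<le> max n m"
  shows "n * m < card (c ` ({..<n} \<times> {..<m})) + max n m"
proof -
  interpret T: linear_grid_coloring m n "c \<circ> prod.swap" by (rule transpose)
  \<comment> \<open>These rewrites state the transposed results in terms of \<open>c\<close> and the
    original grid.\<close>
  note T_simps = row_pair_transpose col_pair_transpose card_colors_transpose
    mult.commute[of m n] max.commute[of m n]
  note T_two_rows = T.card_colors_two_rows[unfolded T_simps]
  note T_column = T.card_colors_ge_column[unfolded T_simps]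
  note T_one = T.card_colors_one_row_one_col[unfolded T_simps]
  show ?thesis
  proof (cases "\<exists>i j j' i' k k'. row_pair i j j' \<and> row_pair i' k k' \<and> i \<noteq> i'")
    case True
    then show ?thesis using card_colors_two_rows[OF N] by blast
  next
    case rows: False
    show ?thesis
    proof (cases "\<exists>l l' k r r' k'. col_pair l l' k \<and> col_pair r r' k' \<and> k \<noteq> k'")
      case True
      then show ?thesis using T_two_rows[OF N] by blast
    next
      case cols: False
      show ?thesis
      proof (cases "\<exists>i j j'. row_pair i j j'")
        case True
        then obtain i j j' where p: "row_pair i j j'" by blast
        have row: "i' = i" if "row_pair i' k k'" for i' k k'
          using rows p that by metis
        show ?thesis
        proof (cases "\<exists>l l' k. col_pair l l' k")
          case True
          then obtain l l' k where q: "col_pair l l' k" by blast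
          have col: "k' = k" if "col_pair r r' k'" for r r' k'
            using cols q that by metis
          \<comment> \<open>The pairs meet in a common column or, after transposition, in a common
            row.\<close>
          from row_col_pair_meet[OF p q] show ?thesis
          proof
            assume "k \<in> {j, j'}"
            then show ?thesis
              by (rule card_colors_one_row_one_col[OF p q _ row col])
          next
            assume "i \<in> {l, l'}"
            then show ?thesis
              by (rule T_one[OF q p _ col row])
          qed
        next
          case no_col: False
          show ?thesis
          \<comment> \<open>All pairs lie in row \<open>i\<close>; the row is deleted except for the
            cell \<open>(i, j)\<close>.\<close>
          proof (rule T_column)
            show "j < m" using p by (simp add: row_pair_def)
          qed (use no_col in blast, rule row)
        qed
      next
        case no_row: False
        show ?thesis
        proof (cases "\<exists>l l' k. col_pair l l' k")
          case True
          then obtain l l' k where q: "col_pair l l' k" by blast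
          have col: "k' = k" if "col_pair r r' k'" for r r' k'
            using cols q that by metis
          show ?thesis
          proof (rule card_colors_ge_column)
            show "l < n" using q by (simp add: col_pair_def)
          qed (use no_row in blast, rule col)
        next
          case False
          then have "n * m \<le> card (c ` ({..<n} \<times> {..<m})) + card ({} :: (nat \<times> nat) set)"
            using no_row by (intro card_colors_ge) auto
          then show ?thesis using N by simp
        qed
      qed
    qed
  qed
qed

end

section \<open>Centered and linear colorings\<close>

lemma connected_invariant:
  assumes H: "wf_digraph H" "symmetric H" "connected H"
    and uv: "u \<in> verts H" "v \<in> verts H" and "P u"
    and step: "\<And>x y. P x \<Longrightarrow> x \<rightarrow>\<^bsub>H\<^esub> y \<Longrightarrow> P y"
  shows "P v"
proof -
  interpret wf_digraph H by (rule H)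
  have "u \<rightarrow>\<^sup>*\<^bsub>mk_symmetric H\<^esub> v"
    using H(3) uv by (simp add: connected_def strongly_connected_def)
  then have "u \<rightarrow>\<^sup>*\<^bsub>H\<^esub> v"
    by (simp add: reachable_mk_symmetric_eq[OF H(2)])
  then show ?thesis
    by (induction rule: reachable_induct) (auto intro: \<open>P u\<close> step)
qed

lemma (in wf_digraph) vwalk_imp_reachable_hd:
  assumes "vwalk p G" "v \<in> set p"
  shows "hd p \<rightarrow>\<^sup>* v"
  using assms
proof (induction rule: vwalk_induct)
  case (Cons u w p)
  show ?case
  proof (cases "v = u")
    case True
    then show ?thesis using adj_in_verts(1)[OF Cons.hyps] by simp
  next
    case False
    then have "w \<rightarrow>\<^sup>* v" using Cons.IH Cons.prems by simp
    then show ?thesis using adj_reachable_trans[OF Cons.hyps] by simp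
  qed
qed simp

text \<open>Unique colors depend only on the vertex set, so a path may be replaced by the subgraph
  induced on its vertices, which is symmetric and connected.\<close>

lemma centered_imp_linear_coloring:
  assumes G: "pair_graph G" and c: "centered_coloring G c"
  shows "linear_coloring G c"
  unfolding linear_coloring_def
proof (intro allI impI)
  fix p assume "vpath p G"
  then have p: "vwalk p G" by (simp add: vpath_def)
  interpret pair_graph G by (rule G)
  let ?H = "with_proj G \<restriction> set p"
  interpret H: wf_digraph ?H by (rule wellformed_induce_subgraph)
  have "set p \<subseteq> pverts G" using p by (auto simp: vwalk_def)
  then have ind: "induced_subgraph ?H G" by (rule induced_induce)
  have sym: "symmetric ?H"
    by (rule induced_graph_imp_symmetric[OF sym_arcs ind])
  \<comment> \<open>This keeps the arcs of the walk inside the induced subgraph.\<close>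
  have arcs: "set (vwalk_arcs q) \<subseteq> set q \<times> set q" for q :: "'a list"
    by (induction q rule: vwalk_arcs.induct) auto
  have "arcs_ends ?H = parcs G \<inter> (set p \<times> set p)"
    by (auto simp: arcs_ends_conv)
  then have "vwalk p ?H"
    using p arcs[of p] by (simp add: vwalk_def)
  then have hd: "hd p \<rightarrow>\<^sup>*\<^bsub>?H\<^esub> v" if "v \<in> set p" for v
    using that by (rule H.vwalk_imp_reachable_hd)
  have "u \<rightarrow>\<^sup>*\<^bsub>?H\<^esub> v" if "u \<in> set p" "v \<in> set p" for u v
    using symmetric_reachable[OF sym hd[OF that(1)]] hd[OF that(2)] by (rule H.reachable_trans)
  moreover have "set p \<noteq> {}"
    using p by (simp add: vwalk_def)
  ultimately have "connected ?H"
    by (simp add: connected_def strongly_connected_def H.reachable_mk_symmetric_eq[OF sym])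
  then have "has_unique_color c (verts ?H)"
    using c sym induced_imp_subgraph[OF ind] unfolding centered_coloring_def by blast
  then show "has_unique_color c (set p)" by simp
qed

lemma complement_rook_graph_verts:
  "pverts (complement_graph (rook_graph n m)) = {..<n} \<times> {..<m}"
  by (simp add: complement_graph_def rook_graph_def)

lemma linear_coloring_complement_rook:
  assumes "linear_coloring (complement_graph (rook_graph n m)) c"
  shows "linear_grid_coloring n m c"
proof
  fix ps :: "(nat \<times> nat) list"
  let ?G = "with_proj (complement_graph (rook_graph n m))"
  assume ps: "ps \<noteq> []" "distinct ps" "set ps \<subseteq> {..<n} \<times> {..<m}"
    "successively (\<lambda>u v. fst u \<noteq> fst v \<and> snd u \<noteq> snd v) ps"
  from ps(1,3,4) have "vwalk ps ?G"
  proof (induction ps rule: induct_list012)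
    case (3 u v ps)
    then show ?case
      by (auto simp: vwalk_def complement_rook_graph_arcs complement_rook_graph_verts)
  qed (auto simp: vwalk_def complement_rook_graph_verts)
  then show "has_unique_color c (set ps)"
    using assms ps(2) by (auto simp: linear_coloring_def vpath_def)
qed

section \<open>Optimal colorings and exact values\<close>

lemma chi_eqI:
  assumes G: "pair_graph G" and c: "centered_coloring G c" "card (c ` pverts G) = k"
    and lower: "\<And>c. linear_coloring G c \<Longrightarrow> k \<le> card (c ` pverts G)"
  shows "chi_cen G = k \<and> chi_lin G = k"
  unfolding chi_cen_def chi_lin_def
  \<comment> \<open>Since centered colorings are linear, \<open>c\<close> bounds both numbers from
    above and \<open>lower\<close> bounds both from below.\<close>
  using c lower centered_imp_linear_coloring[OF G]
  by (intro conjI Least_equality) auto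

text \<open>A connected subgraph either contains a vertex with a private color or lies in
  \<open>I\<close>, where the absence of arcs leaves it a single vertex.\<close>

lemma centered_coloring_independent_set:
  assumes indep: "\<And>u v. u \<in> I \<Longrightarrow> v \<in> I \<Longrightarrow> \<not> u \<rightarrow>\<^bsub>G\<^esub> v"
    and inj: "\<And>u v. u \<in> verts G - I \<Longrightarrow> v \<in> verts G \<Longrightarrow> c v = c u \<Longrightarrow> v = u"
  shows "centered_coloring G c"
  unfolding centered_coloring_def
proof (intro allI impI, elim conjE)
  fix H assume H: "subgraph H G" "symmetric H" "connected H"
  then interpret wf_digraph H by auto
  have sub: "verts H \<subseteq> verts G" using H(1) by auto
  show "has_unique_color c (verts H)"
  proof (cases "verts H \<subseteq> I")
    case False
    then obtain v where "v \<in> verts H" "v \<notin> I" by blast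
    then show ?thesis
      using inj[of v] sub unfolding has_unique_color_def by blast
  next
    case True
    have "verts H \<noteq> {}"
      using H(3) by (simp add: connected_def strongly_connected_def)
    then obtain u where u: "u \<in> verts H" by blast
    have "v = u" if "v \<in> verts H" for v
    proof (rule connected_invariant[OF wf_digraph_axioms H(2,3) u that, where P = "\<lambda>x. x = u"])
      fix x y assume "x = u" "x \<rightarrow>\<^bsub>H\<^esub> y"
      then show "y = u"
        using indep[of x y] True arcs_ends_mono[OF H(1)] adj_in_verts[of x y] by blast
    qed simp
    then show ?thesis
      using u unfolding has_unique_color_def by blast
  qed
qed

lemma chi_complement_rook:
  assumes "m \<ge> 1" "n \<ge> m"
    and lower: "\<And>c. linear_coloring (complement_graph (rook_graph n m)) c \<Longrightarrow>
      n * m < card (c ` ({..<n} \<times> {..<m})) + n"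
  shows "chi_cen (complement_graph (rook_graph n m)) = n * m - n + 1 \<and>
    chi_lin (complement_graph (rook_graph n m)) = n * m - n + 1"
proof (rule chi_eqI)
  let ?G = "complement_graph (rook_graph n m)" and ?V = "{..<n} \<times> {..<m}"
  note V = complement_rook_graph_verts[of n m]
  define c :: "nat \<times> nat \<Rightarrow> int"
    \<comment> \<open>Column 0 is the independent set; the shift by 1 keeps the private colors from
      \<open>prod_encode\<close> away from 0.\<close>
    where "c v = (if snd v = 0 then 0 else 1 + int (prod_encode v))" for v
  show "pair_graph ?G"
    by (intro pair_graph_complement_graph pair_graph_rook_graph)
  show "centered_coloring ?G c"
    by (rule centered_coloring_independent_set[where I = "{v. snd v = 0}"])
      (auto simp: c_def complement_rook_graph_arcs split: if_splits)
  have "?V = {..<n} \<times> {0} \<union> {..<n} \<times> {1..<m}"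
    using assms(1) by auto
  moreover have "c ` ({..<n} \<times> {0}) = {0}"
    using assms by (auto simp: c_def image_iff intro!: exI[of _ 0])
  ultimately have img: "c ` ?V = insert 0 (c ` ({..<n} \<times> {1..<m}))"
    by (simp add: image_Un)
  have "inj_on c ({..<n} \<times> {1..<m})"
    by (rule inj_onI) (auto simp: c_def split: if_splits)
  then have "card (c ` ({..<n} \<times> {1..<m})) = n * (m - 1)"
    by (simp add: card_image card_cartesian_product)
  moreover have "0 \<notin> c ` ({..<n} \<times> {1..<m})"
    by (auto simp: c_def)
  ultimately show "card (c ` pverts ?G) = n * m - n + 1"
    by (simp add: V img diff_mult_distrib2)
  show "n * m - n + 1 \<le> card (c' ` pverts ?G)" if "linear_coloring ?G c'" for c'
    using lower[OF that] assms unfolding V by (cases m) auto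
qed

text \<open>The graph consists of two disjoint edges, the diagonal and the antidiagonal, each with
  one vertex in either column.\<close>

lemma centered_coloring_snd_2x2:
  "centered_coloring (complement_graph (rook_graph 2 2)) (\<lambda>v. int (snd v))"
  unfolding centered_coloring_def
proof (intro allI impI, elim conjE)
  let ?G = "complement_graph (rook_graph 2 2)"
  fix H assume H: "subgraph H ?G" "symmetric H" "connected H"
  then interpret wf_digraph H by auto
  have sub: "verts H \<subseteq> {..<2} \<times> {..<2}"
    using subgraph_imp_subverts[OF H(1)] by (simp add: complement_rook_graph_verts)
  have "verts H \<noteq> {}"
    using H(3) by (simp add: connected_def strongly_connected_def)
  then obtain u where u: "u \<in> verts H" by blast
  have "v = u" if "v \<in> verts H" "snd v = snd u" for v
  proof -
    \<comment> \<open>The invariant tells which of the two edges holds a vertex; together with the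
      column it determines the vertex.\<close>
    have "(fst v = snd v) = (fst u = snd u)"
    proof (rule connected_invariant[OF wf_digraph_axioms H(2,3) u that(1),
          where P = "\<lambda>x. (fst x = snd x) = (fst u = snd u)"])
      fix x y assume x: "(fst x = snd x) = (fst u = snd u)" and "x \<rightarrow>\<^bsub>H\<^esub> y"
      then have "(x, y) \<in> parcs ?G"
        using arcs_ends_mono[OF H(1)] by auto
      then show "(fst y = snd y) = (fst u = snd u)"
        using x by (auto simp: complement_rook_graph_arcs less_2_cases_iff)
    qed simp
    moreover have "u \<in> {..<2} \<times> {..<2}" "v \<in> {..<2} \<times> {..<2}"
      using sub u that(1) by blast+
    ultimately show ?thesis
      using that(2) by (cases u; cases v; simp) linarith
  qed
  then show "has_unique_color (\<lambda>v. int (snd v)) (verts H)"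
    using u unfolding has_unique_color_def of_nat_eq_iff by blast
qed

lemma chi_complement_rook_2x2:
  "chi_cen (complement_graph (rook_graph 2 2)) = 2 \<and> chi_lin (complement_graph (rook_graph 2 2)) = 2"
proof (rule chi_eqI)
  let ?G = "complement_graph (rook_graph 2 2)"
  show "pair_graph ?G"
    by (intro pair_graph_complement_graph pair_graph_rook_graph)
  show "centered_coloring ?G (\<lambda>v. int (snd v))"
    by (rule centered_coloring_snd_2x2)
  have "(\<lambda>v. int (snd v)) ` pverts ?G = int ` snd ` ({..<2::nat} \<times> {..<2::nat})"
    unfolding complement_rook_graph_verts by (rule image_image[symmetric])
  also have "snd ` ({..<2::nat} \<times> {..<2::nat}) = {..<2}"
    by (rule snd_image_times[THEN trans]) (simp add: lessThan_empty_iff)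
  finally show "card ((\<lambda>v. int (snd v)) ` pverts ?G) = 2"
    by (simp add: card_image)
  fix c assume "linear_coloring ?G c"
  then interpret linear_grid_coloring 2 2 c by (rule linear_coloring_complement_rook)
  have "card {c (0, 0), c (1, 1)} \<le> card (c ` pverts ?G)"
    unfolding complement_rook_graph_verts by (intro card_mono) auto
  then show "2 \<le> card (c ` pverts ?G)"
    using adjacent_colors_differ[of 0 1 0 1] by simp
qed

theorem theorem4p6:
  fixes n m :: nat
  assumes "n \<ge> m" and "m \<ge> 1"
  shows "chi_cen (complement_graph (rook_graph n m)) =
           (if m \<ge> 2 \<and> n \<ge> 3 then n * m - n + 1 else m) \<and>
         chi_lin (complement_graph (rook_graph n m)) =
           (if m \<ge> 2 \<and> n \<ge> 3 then n * m - n + 1 else m)"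
proof -
  \<comment> \<open>For \<open>m = 1\<close> the general formula also gives \<open>m\<close>, with a
    lower bound that only says some color occurs. The 2 by 2 grid is the exception: the formula
    would give 3 instead of 2.\<close>
  consider (large) "m \<ge> 2" "n \<ge> 3" | (one) "m = 1" | (two) "n = 2" "m = 2"
    using assms by linarith
  then show ?thesis
  proof cases
    case large
    have "n * m < card (c ` ({..<n} \<times> {..<m})) + n"
      if "linear_coloring (complement_graph (rook_graph n m)) c" for c
      using linear_grid_coloring.card_colors_grid[OF linear_coloring_complement_rook[OF that]]
        large assms by (simp add: max_absorb1)
    then show ?thesis
      using chi_complement_rook[of m n] large assms by simp
  next
    case one
    have "0 < card (c ` ({..<n} \<times> {..<1}))" for c :: "nat \<times> nat \<Rightarrow> int"
      using assms by (subst card_gt_0_iff) (auto simp: lessThan_empty_iff)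
    then show ?thesis
      using chi_complement_rook[of 1 n] one assms by simp
  next
    case two
    then show ?thesis using chi_complement_rook_2x2 by simp
  qed
qed

end
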